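(* Let $N\ge 1$, $p\ge 0$ and $k$ be integers with $p<k\leqslant N$, let $x^k\in L_k$, and let $f:\{0,1\}^N\to\{0,1\}$ be a monotone Boolean function that is ideal with respect to $x^k$. Then for every inlier $i$ (i.e. $x^k_i=1$) and every outlier $j$ (i.e. $x^k_j=0$), $$2^N\bigl(\hat f(j)-\hat f(i)\bigr)=\sum_{l=p+1}^{k}\binom{k}{l}+\binom{k-1}{p}>0.$$
   Context: $\{0,1\}^N$ carries the componentwise partial order; $f:\{0,1\}^N\to\{0,1\}$ is monotone if $x\le y$ implies $f(x)\le f(y)$. $\|x\|_1$ is the number of ones in $x$; $L_k=\{x\in\{0,1\}^N:\|x\|_1=k\}$ and $L_{\leqslant k}=\{x:\|x\|_1\leqslant k\}$. $\Delta(x,y)=\#\{i:x_i\ne y_i\}$ is the Hamming distance. For $x^k\in L_k$ with $k>p$, the Boolean sub-cube determined by $x^k$ is $B_{x^k}=\{x\in\{0,1\}^N:\Delta(x,x^k)=i,\ x\in L_{k-i},\ 0\leqslant i\leqslant k-p-1\}$, i.e. the set of all $x\le x^k$ with $p+1\le\|x\|_1\le k$. A monotone Boolean function $f$ is called ideal with respect to $x^k\in L_k$ ($p<k\le N$) if $f(x)=0$ for all $x\in B_{x^k}\cup L_{\leqslant p}$ and $f(x)=1$ for all other $x$. Influence: for $i\in\{1,\dots,N\}$, $\hat f(i)=2^{-N}\sum_{x\in\{0,1\}^N}f(x)(-1)^{1+x_i}$. For monotone $f$, $2^N\hat f(i)$ is the number of $x\in\{0,1\}^N$ with $x_i=0$,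 $f(x)=0$ and $f(x+e_i)=1$, where $x+e_i$ is $x$ with the $i$-th bit changed to $1$. Binomial coefficients $\binom{a}{b}$ are $0$ if $b>a$. *)

theory Defs
  imports Complex_Main "HOL-Library.Cardinality"
begin

text \<open>
  The cube of dimension N is the type \<open>'n \<Rightarrow> bool\<close> for a finite index type \<open>'n\<close> with
  \<open>N = CARD('n)\<close>; \<open>True\<close> stands for the bit 1. The library orders on \<open>bool\<close> and on
  functions give the componentwise order, so monotone Boolean functions are those with \<open>mono f\<close>.
\<close>

type_synonym 'n cube = "'n \<Rightarrow> bool"

definition weight :: "'n::finite cube \<Rightarrow> nat" where
  "weight x = card {i. x i}"

definition layer :: "nat \<Rightarrow> 'n::finite cube set" where
  "layer k = {x. weight x = k}"

definition layers_upto :: "nat \<Rightarrow> 'n::finite cube set" where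
  "layers_upto k = {x. weight x \<le> k}"

definition hamming :: "'n::finite cube \<Rightarrow> 'n cube \<Rightarrow> nat" where
  "hamming x y = card {i. x i \<noteq> y i}"

text \<open>
  Intended for \<open>p < k\<close> and \<open>xk \<in> layer k\<close>, where the natural-number
  subtractions below do not truncate.
\<close>

definition subcube :: "nat \<Rightarrow> nat \<Rightarrow> 'n::finite cube \<Rightarrow> 'n cube set" where
  "subcube p k xk = {x. \<exists>i. i \<le> k - p - 1 \<and> hamming x xk = i \<and> x \<in> layer (k - i)}"

definition ideal_wrt :: "nat \<Rightarrow> nat \<Rightarrow> 'n::finite cube \<Rightarrow> ('n cube \<Rightarrow> bool) \<Rightarrow> bool" where
  "ideal_wrt p k xk f \<longleftrightarrow>
     (\<forall>x \<in> subcube p k xk \<union> layers_upto p. f x = False) \<and>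
     (\<forall>x. x \<notin> subcube p k xk \<union> layers_upto p \<longrightarrow> f x = True)"

definition influence :: "('n::finite cube \<Rightarrow> bool) \<Rightarrow> 'n \<Rightarrow> real" where
  "influence f i =
     1 / 2 ^ CARD('n) * (\<Sum>x\<in>UNIV. of_bool (f x) * (- 1) ^ (1 + of_bool (x i)))"

end

theory Submission
  imports Defs "HOL-Combinatorics.Transposition"
begin

text \<open>
  Up to a factor 2, the difference of the influences is the signed sum of \<open>x\<^sub>j - x\<^sub>i\<close> over all points
  where \<open>f\<close> is 1, that is, over the layers above \<open>p\<close> with the sub-cube removed. Swapping the
  coordinates \<open>i\<close> and \<open>j\<close> shows that the full layers contribute nothing. In the removed sub-cube the
  outlier \<open>j\<close> is always 0, so what remains is the number of its points with \<open>x\<^sub>i = 1\<close>.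
\<close>

lemma weight_comp_transpose: "weight (x \<circ> transpose i j) = weight x"
proof -
  have "{l. x l} = transpose i j ` {l. (x \<circ> transpose i j) l}"
    by (auto simp: image_iff) (metis transpose_involutory)
  then show ?thesis
    by (metis card_image inj_on_transpose weight_def)
qed

text \<open>Let \<open>A\<close> and \<open>K\<close> be the supports of \<open>x\<close> and
  \<open>xk\<close>, \<open>a = card (A - K)\<close> and \<open>b = card (K - A)\<close>. Then the
  Hamming distance is \<open>a + b\<close>, while the weight of \<open>x\<close> is
  \<open>k + a - b\<close>. Requiring the weight to be \<open>k - (a + b)\<close> forces
  \<open>a = 0\<close>, that is \<open>x \<le> xk\<close>; the bound on the distance then says that
  the weight exceeds \<open>p\<close>.\<close>

lemma subcube_eq:
  fixes xk :: "'n::finite cube"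
  assumes "xk \<in> layer k" "p < k"
  shows "subcube p k xk = {x. x \<le> xk \<and> p < weight x}"
proof (rule set_eqI)
  fix x :: "'n cube"
  define A K where "A = {i. x i}" and "K = {i. xk i}"
  have k: "card K = k" using assms by (simp add: layer_def weight_def K_def)
  have w: "weight x = card A" by (simp add: weight_def A_def)
  have "{i. x i \<noteq> xk i} = (A - K) \<union> (K - A)" by (auto simp: A_def K_def)
  then have h: "hamming x xk = card (A - K) + card (K - A)"
    unfolding hamming_def by (simp add: card_Un_disjoint Diff_Int_distrib2 Diff_triv)
  have le: "x \<le> xk \<longleftrightarrow> card (A - K) = 0"
    by (auto simp: A_def K_def le_fun_def)
  have "card A = card (A \<inter> K) + card (A - K)" "card K = card (A \<inter> K) + card (K - A)"
    by (metis card_Int_Diff finite, metis card_Int_Diff finite Int_commute)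
  moreover have "x \<in> subcube p k xk \<longleftrightarrow>
      hamming x xk \<le> k - p - 1 \<and> weight x = k - hamming x xk"
    by (auto simp: subcube_def layer_def)
  ultimately show "x \<in> subcube p k xk \<longleftrightarrow> x \<in> {x. x \<le> xk \<and> p < weight x}"
    using assms(2) unfolding mem_Collect_eq le h w k by linarith
qed

lemma card_subsets_ge:
  assumes "finite S"
  shows "card {B. B \<subseteq> S \<and> p \<le> card B} = (\<Sum>m=p..card S. card S choose m)"
proof -
  have "{B. B \<subseteq> S \<and> p \<le> card B} = (\<Union>m\<in>{p..card S}. {B. B \<subseteq> S \<and> card B = m})"
    using card_mono[OF assms] by auto
  also have "card \<dots> = (\<Sum>m=p..card S. card {B. B \<subseteq> S \<and> card B = m})"
    using assms by (intro card_UN_disjoint) auto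
  finally show ?thesis
    using assms by (simp add: n_subsets)
qed

text \<open>Deleting \<open>i\<close> from the support gives a bijection onto subsets of the other
  \<open>k - 1\<close> ones of \<open>xk\<close>. The size drops by one, so the strict bound
  \<open>p < weight x\<close> becomes \<open>p \<le> card B\<close>.\<close>

lemma card_below_with_coordinate:
  fixes xk :: "'n::finite cube"
  assumes "xk \<in> layer k" "xk i"
  shows "card {x. x \<le> xk \<and> p < weight x \<and> x i} = (\<Sum>m=p..k-1. (k - 1) choose m)"
proof -
  define S where "S = {l. xk l} - {i}"
  have S: "card S = k - 1" using assms by (simp add: S_def layer_def weight_def)
  have weight_remove: "weight x = Suc (card ({l. x l} - {i}))" if "x i" for x :: "'n cube"
    using card.remove[of "{l. x l}" i] that by (simp add: weight_def)
  have weight_insert: "weight (\<lambda>l. l \<in> insert i B) = Suc (card B)" if "B \<subseteq> S" for B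
    unfolding weight_def Collect_mem_eq
    by (rule card_insert_disjoint) (use that in \<open>auto simp: S_def\<close>)
  have "bij_betw (\<lambda>B l. l \<in> insert i B) {B. B \<subseteq> S \<and> p \<le> card B}
          {x. x \<le> xk \<and> p < weight x \<and> x i}"
  proof (rule bij_betw_byWitness[where f' = "\<lambda>x. {l. x l} - {i}"])
    show "\<forall>B\<in>{B. B \<subseteq> S \<and> p \<le> card B}. {l. l \<in> insert i B} - {i} = B"
      by (auto simp: S_def)
    show "\<forall>x\<in>{x. x \<le> xk \<and> p < weight x \<and> x i}. (\<lambda>l. l \<in> insert i ({l. x l} - {i})) = x"
      by (auto simp: fun_eq_iff)
    show "(\<lambda>x. {l. x l} - {i}) ` {x. x \<le> xk \<and> p < weight x \<and> x i}
        \<subseteq> {B. B \<subseteq> S \<and> p \<le> card B}"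
      using weight_remove by (fastforce simp: S_def le_fun_def)
    show "(\<lambda>B l. l \<in> insert i B) ` {B. B \<subseteq> S \<and> p \<le> card B}
        \<subseteq> {x. x \<le> xk \<and> p < weight x \<and> x i}"
    proof (intro image_subsetI CollectI conjI)
      fix B assume "B \<in> {B. B \<subseteq> S \<and> p \<le> card B}"
      then have B: "B \<subseteq> S" "p \<le> card B" by auto
      show "(\<lambda>l. l \<in> insert i B) \<le> xk"
        using B(1) assms(2) by (auto simp: S_def le_fun_def)
      show "p < weight (\<lambda>l. l \<in> insert i B)"
        using weight_insert[OF B(1)] B(2) by linarith
    qed simp
  qed
  from bij_betw_same_card[OF this] show ?thesis
    by (simp only: card_subsets_ge[OF finite] S)
qed

text \<open>Pascal's rule splits the tail of row \<open>Suc n\<close> into two tails of row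
  \<open>n\<close>, starting at \<open>p\<close> and at \<open>p + 1\<close>. The extra
  \<open>n choose p\<close> completes the second one. This turns twice the count of sub-cube points
  into the closed form of the theorem.\<close>

lemma binomial_tail_Suc:
  assumes "p \<le> n"
  shows "(\<Sum>l=p+1..Suc n. Suc n choose l) + (n choose p) = 2 * (\<Sum>m=p..n. n choose m)"
proof -
  have "(\<Sum>l=p+1..Suc n. Suc n choose l) = (\<Sum>m=p..n. Suc n choose Suc m)"
    using sum.shift_bounds_cl_Suc_ivl[of "\<lambda>l. Suc n choose l" p n] by simp
  also have "\<dots> = (\<Sum>m=p..n. n choose m) + (\<Sum>m=p..n. n choose Suc m)"
    by (simp add: sum.distrib)
  \<comment> \<open>The index shift yields the upper limit \<open>Suc n\<close>, but the top term
    \<open>n choose Suc n\<close> is 0.\<close>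
  also have "(\<Sum>m=p..n. n choose Suc m) = (\<Sum>m=Suc p..n. n choose m)"
    using sum.shift_bounds_cl_Suc_ivl[of "\<lambda>l. n choose l" p n] assms by (simp add: binomial_eq_0)
  finally show ?thesis
    using sum.atLeast_Suc_atMost[OF assms, of "\<lambda>m. n choose m"] by simp
qed

lemma sum_coordinate_diff_above_layer:
  "(\<Sum>x | p < weight x. of_bool (x j) - of_bool (x i) :: real) = 0"
proof -
  have "(\<Sum>x | p < weight x. of_bool (x j) :: real) = (\<Sum>x | p < weight x. of_bool (x i))"
    \<comment> \<open>The swap is an involution, so it serves as its own inverse witness.\<close>
    by (rule sum.reindex_bij_witness[where i = "\<lambda>x. x \<circ> transpose i j" and j = "\<lambda>x. x \<circ> transpose i j"])
      (auto simp: weight_comp_transpose comp_assoc)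
  then show ?thesis by (simp add: sum_subtractf)
qed

text \<open>For a bit b the sign \<open>(- 1) ^ (1 + b)\<close> equals 2b - 1. The constant cancels
  in the difference and the factor 2 remains.\<close>

lemma influence_diff:
  fixes f :: "'n::finite cube \<Rightarrow> bool"
  shows "2 ^ CARD('n) * (influence f j - influence f i)
    = 2 * (\<Sum>x | f x. of_bool (x j) - of_bool (x i))"
proof -
  have scaled: "2 ^ CARD('n) * influence f l = (\<Sum>x\<in>UNIV. of_bool (f x) * (- 1) ^ (1 + of_bool (x l)))" for l
    unfolding influence_def by simp
  have "2 ^ CARD('n) * (influence f j - influence f i)
      = (\<Sum>x\<in>UNIV. of_bool (f x) * (- 1) ^ (1 + of_bool (x j))
          - of_bool (f x) * (- 1) ^ (1 + of_bool (x i)))"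
    by (simp only: right_diff_distrib scaled sum_subtractf)
  also have "\<dots> = (\<Sum>x\<in>UNIV. if f x then 2 * (of_bool (x j) - of_bool (x i)) else 0)"
    by (rule sum.cong) (auto split: split_of_bool)
  also have "\<dots> = (\<Sum>x | f x. 2 * (of_bool (x j) - of_bool (x i)))"
    by (subst sum.inter_filter[symmetric]) auto
  also have "\<dots> = 2 * (\<Sum>x | f x. of_bool (x j) - of_bool (x i))"
    by (rule sum_distrib_left[symmetric])
  finally show ?thesis .
qed

theorem corollary1p1:
  fixes p k :: nat and xk :: "'n::finite cube" and f :: "'n cube \<Rightarrow> bool" and i j :: 'n
  assumes "p < k" and "k \<le> CARD('n)"
    and "xk \<in> layer k"
    and "mono f"
    and "ideal_wrt p k xk f"
    and inlier: "xk i"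
    and outlier: "\<not> xk j"
  shows "2 ^ CARD('n) * (influence f j - influence f i)
           = real ((\<Sum>l=p+1..k. k choose l) + ((k - 1) choose p))
         \<and> real ((\<Sum>l=p+1..k. k choose l) + ((k - 1) choose p)) > 0"
proof
  let ?g = "\<lambda>x::'n cube. of_bool (x j) - of_bool (x i) :: real"
  let ?B = "{x. x \<le> xk \<and> p < weight x}"
  have "f x \<longleftrightarrow> x \<notin> subcube p k xk \<union> layers_upto p" for x
    using assms(5) unfolding ideal_wrt_def by blast
  then have "f x \<longleftrightarrow> x \<notin> ?B \<and> \<not> weight x \<le> p" for x
    by (simp only: subcube_eq[OF assms(3,1)] layers_upto_def Un_iff mem_Collect_eq de_Morgan_disj)
  then have "{x. f x} = {x. p < weight x} - ?B"
    by (simp add: set_eq_iff not_le conj_commute)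
  moreover have "?B \<subseteq> {x. p < weight x}" by blast
  ultimately have "sum ?g {x. f x} = sum ?g {x. p < weight x} - sum ?g ?B"
    using sum_diff[OF finite, of ?B "{x. p < weight x}" ?g] by (simp only:)
  also have "\<dots> = - sum ?g ?B"
    unfolding sum_coordinate_diff_above_layer by (rule diff_0)
  \<comment> \<open>On \<open>?B\<close> the bound \<open>x \<le> xk\<close> makes
    \<open>x j\<close> false, so \<open>- ?g x\<close> is just the bit at \<open>i\<close>.\<close>
  also have "\<dots> = (\<Sum>x\<in>?B. of_bool (x i))"
    using outlier by (subst sum_negf[symmetric], intro sum.cong) (auto simp: le_fun_def)
  also have "\<dots> = real (card {x. x \<le> xk \<and> p < weight x \<and> x i})"
    by (subst sum_of_bool_eq) (auto intro!: arg_cong[where f = card])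
  also have "\<dots> = real (\<Sum>m=p..k-1. (k - 1) choose m)"
    by (simp only: card_below_with_coordinate[OF assms(3) inlier])
  \<comment> \<open>The binomial identity applies with \<open>n = k - 1\<close>, since
    \<open>p < k\<close> gives \<open>p \<le> k - 1\<close> and
    \<open>Suc (k - 1) = k\<close>.\<close>
  finally show "2 ^ CARD('n) * (influence f j - influence f i)
      = real ((\<Sum>l=p+1..k. k choose l) + ((k - 1) choose p))"
    using binomial_tail_Suc[of p "k - 1"] assms(1) unfolding influence_diff by (simp del: of_nat_sum)
  \<comment> \<open>The term \<open>(k - 1) choose p\<close> alone is positive because
    \<open>p \<le> k - 1\<close>.\<close>
  show "real ((\<Sum>l=p+1..k. k choose l) + ((k - 1) choose p)) > 0"
    using assms(1) zero_less_binomial[of p "k - 1"] by linarith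
qed

end
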